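(* Let $\{\gamma_n\}_{n=0}^\infty$ be a sequence of real numbers and $\{Q_k(x)\}_{k=0}^\infty$ a sequence of real polynomials such that $$T[H_n(x)]:=\left(\sum_{k=0}^\infty Q_k(x)D^k\right)H_n(x)=\gamma_nH_n(x)\qquad\text{for all } n\in\mathbb{N}_0.$$ Then for each $n\in\mathbb{N}_0$, $$Q_n(x)=\frac{1}{n!\,2^n}\sum_{k=0}^{n} \binom{n}{k} \gamma_k\, i^{\,n-k}H_{n-k}(ix)H_k(x).$$
   Context: $\mathbb{N}_0=\{0,1,2,\ldots\}$, $D:=\frac{d}{dx}$, and $i$ is the imaginary unit. The Hermite polynomials are $H_n(x)=\sum_{k=0}^{\lfloor n/2\rfloor}\frac{(-1)^k n!\,2^{n-2k}}{k!(n-2k)!}x^{n-2k}$. The operator $\sum_{k}Q_kD^k$ acts on polynomials, so only finitely many terms contribute. *)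

theory Defs
  imports Complex_Main "HOL-Computational_Algebra.Polynomial" "HOL-Library.Groups_Big_Fun"
begin

text \<open>
  The physicists' Hermite polynomials. They are generic in the coefficient field so that the same
  definition yields the real polynomial \<open>H\<^sub>n(x)\<close> and the complex one into which \<open>\<i> x\<close> is substituted.
\<close>

definition hermite :: "nat \<Rightarrow> 'a::field_char_0 poly" where
  "hermite n = (\<Sum>k = 0..n div 2.
     monom ((-1) ^ k * fact n * 2 ^ (n - 2 * k) / (fact k * fact (n - 2 * k))) (n - 2 * k))"

text \<open>
  The formal operator \<open>\<Sum>k. Q\<^sub>k D\<^sup>k\<close>. The sum over all \<open>k\<close> is finitely supported on every polynomial;
  the lemma below confirms that the default value of \<^const>\<open>Sum_any\<close> is never used.
\<close>

definition diff_op :: "(nat \<Rightarrow> 'a::field_char_0 poly) \<Rightarrow> 'a poly \<Rightarrow> 'a poly" where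
  "diff_op Q p = (\<Sum>k. Q k * (pderiv ^^ k) p)"

lemma higher_pderiv_eq_0:
  fixes p :: "'a::field_char_0 poly"
  assumes "degree p < k"
  shows "(pderiv ^^ k) p = 0"
  using assms
proof (induction k arbitrary: p)
  case (Suc k)
  show ?case
  proof (cases "degree p = 0")
    case True
    then have "pderiv p = 0" by (simp add: pderiv_eq_0_iff)
    moreover have "(pderiv ^^ k) (0 :: 'a poly) = 0" by (induction k) auto
    ultimately show ?thesis by (simp add: funpow_Suc_right del: funpow.simps)
  next
    case False
    then have "degree (pderiv p) < k" using Suc.prems by (simp add: degree_pderiv)
    then show ?thesis using Suc.IH by (simp add: funpow_Suc_right del: funpow.simps)
  qed
qed simp

lemma diff_op_eq_sum: "diff_op Q p = (\<Sum>k\<le>degree p. Q k * (pderiv ^^ k) p)"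
  unfolding diff_op_def
proof (rule Sum_any.expand_superset)
  show "{k. Q k * (pderiv ^^ k) p \<noteq> 0} \<subseteq> {..degree p}"
    using higher_pderiv_eq_0[of p] by (force simp: not_le[symmetric])
qed simp

end

theory Submission
  imports Defs "HOL-Computational_Algebra.Formal_Power_Series"
begin

text \<open>
  Write \<open>h\<^sub>n = H\<^sub>n / n!\<close>. Since \<open>D h\<^sub>n = 2 h\<^sub>n\<^sub>-\<^sub>1\<close> (lemma \<open>pderiv_nhermite_Suc\<close>), the eigenvalue
  equation for \<open>h\<^sub>n\<close> reads \<open>\<Sum>k\<le>n. 2\<^sup>k Q\<^sub>k h\<^sub>n\<^sub>-\<^sub>k = \<gamma>\<^sub>n h\<^sub>n\<close>. The left-hand side is a Cauchy
  product, so all these equations together say \<open>S(t) F(t) = E(t)\<close> for the formal power series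
  \<open>S = \<Sum>n. 2\<^sup>n Q\<^sub>n t\<^sup>n\<close>, \<open>F = \<Sum>n. h\<^sub>n t\<^sup>n\<close> and \<open>E = \<Sum>n. \<gamma>\<^sub>n h\<^sub>n t\<^sup>n\<close> over the polynomial ring.

  Informally \<open>F = exp (2 x t - t\<^sup>2)\<close>. Substituting \<open>(\<i> x, \<i> t)\<close> for \<open>(x, t)\<close> changes the sign of the
  exponent, so the inverse of \<open>F\<close> is \<open>G = \<Sum>n. \<i>\<^sup>n h\<^sub>n(\<i> x) t\<^sup>n\<close> (lemma \<open>hermite_gf_mult_inv\<close>).
  Therefore \<open>S = E G\<close>, and the coefficient of \<open>t\<^sup>n\<close> is the claimed formula.

  The exponentials themselves are avoided: the three-term recurrence (lemma \<open>nhermite_recurrence\<close>)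
  says that \<open>F\<close> and \<open>G\<close> solve \<open>F' = (2 x - 2 t) F\<close> and \<open>G' = - (2 x - 2 t) G\<close>, so \<open>F G\<close> has
  derivative \<open>0\<close> in \<open>t\<close> and equals its constant term \<open>1\<close>.
\<close>

section \<open>Normalised Hermite polynomials\<close>

text \<open>
  Dividing by \<open>n!\<close> absorbs the falling factorials in the derivatives of \<open>H\<^sub>n\<close> and turns the
  binomial convolution of the theorem into a Cauchy product.
\<close>

definition nhermite :: "nat \<Rightarrow> 'a::field_char_0 poly" where
  "nhermite n = smult (1 / fact n) (hermite n)"

lemma hermite_eq_nhermite: "hermite n = smult (fact n) (nhermite n)"
  by (simp add: nhermite_def)

text \<open>
  The coefficient of \<open>x\<^sup>j\<close> can only come from the summand \<open>k\<close> with \<open>n - 2 k = j\<close>; reading the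
  defining sum this way makes polynomial identities checkable one coefficient at a time.
\<close>

lemma coeff_nhermite:
  "coeff (nhermite n :: 'a::field_char_0 poly) j =
     (if j \<le> n \<and> even (n - j)
      then (-1) ^ ((n - j) div 2) * 2 ^ j / (fact ((n - j) div 2) * fact j) else 0)"
proof -
  let ?c = "\<lambda>k. (-1) ^ k * fact n * 2 ^ (n - 2 * k) / (fact k * fact (n - 2 * k)) :: 'a"
  have "coeff (hermite n) j = (\<Sum>k = 0..n div 2. if n - 2 * k = j then ?c k else 0)"
    by (simp add: hermite_def coeff_sum)
  also have "\<dots> = (\<Sum>k = 0..n div 2. if (n - j) div 2 = k
                     then if j \<le> n \<and> even (n - j) then ?c k else 0 else 0)"
  proof (intro sum.cong refl)
    fix k assume "k \<in> {0..n div 2}"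
    then have "2 * k \<le> n" by simp
    then have "n - 2 * k = j \<longleftrightarrow> (n - j) div 2 = k \<and> j \<le> n \<and> even (n - j)"
      by (metis add_diff_cancel_left' dvd_mult_div_cancel diff_diff_cancel diff_le_self dvd_triv_left
          nonzero_mult_div_cancel_left zero_neq_numeral)
    then show "(if n - 2 * k = j then ?c k else 0) =
        (if (n - j) div 2 = k then if j \<le> n \<and> even (n - j) then ?c k else 0 else 0)"
      by auto
  qed
  also have "\<dots> = (if j \<le> n \<and> even (n - j) then ?c ((n - j) div 2) else 0)"
    by (simp add: sum.delta' div_le_mono)
  finally show ?thesis
    by (auto simp: nhermite_def elim!: evenE)
qed

lemma nhermite_0: "nhermite 0 = 1"
  by (simp add: nhermite_def hermite_def monom_0)

lemma degree_nhermite_le: "degree (nhermite n) \<le> n"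
  by (rule degree_le) (auto simp: coeff_nhermite)

lemma pderiv_nhermite_Suc: "pderiv (nhermite (Suc n)) = smult 2 (nhermite n)"
  by (rule poly_eqI) (auto simp: coeff_pderiv coeff_nhermite field_simps simp del: of_nat_Suc)

lemma higher_pderiv_nhermite:
  "k \<le> n \<Longrightarrow> (pderiv ^^ k) (nhermite n) = smult (2 ^ k) (nhermite (n - k))"
proof (induction k)
  case (Suc k)
  then have "n - k = Suc (n - Suc k)" by simp
  with Suc show ?case
    by (simp add: pderiv_smult pderiv_nhermite_Suc mult.commute)
qed simp

lemma nhermite_1: "nhermite (Suc 0) = [:0, 2:]"
  by (simp add: nhermite_def hermite_def monom_altdef)

lemma coeff_nhermite_add:
  "coeff (nhermite (j + 2 * m) :: 'a::field_char_0 poly) j = (-1) ^ m * 2 ^ j / (fact m * fact j)"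
  by (simp add: coeff_nhermite)

text \<open>
  Write \<open>c\<close> for the coefficient of \<open>x\<^sup>j\<close> in \<open>h\<^sub>n\<^sub>+\<^sub>2\<close>, where \<open>n + 2 = j + 2 m\<close>. The factor \<open>n + 2\<close> splits
  accordingly: \<open>j c\<close> is the contribution of \<open>2 x h\<^sub>n\<^sub>+\<^sub>1\<close> because \<open>j\<close> cancels against \<open>j!\<close>, and
  \<open>2 m c\<close> is that of \<open>- 2 h\<^sub>n\<close> because \<open>m\<close> cancels against \<open>m!\<close>.
\<close>

lemma nhermite_recurrence:
  "smult (of_nat (Suc (Suc n))) (nhermite (Suc (Suc n))) =
     smult 2 (pCons 0 (nhermite (Suc n))) - smult 2 (nhermite n :: 'a::field_char_0 poly)"
proof (rule poly_eqI)
  fix j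
  show "coeff (smult (of_nat (Suc (Suc n))) (nhermite (Suc (Suc n)))) j =
     coeff (smult 2 (pCons 0 (nhermite (Suc n))) - smult 2 (nhermite n :: 'a poly)) j"
  proof (cases "j \<le> Suc (Suc n) \<and> even (Suc (Suc n) - j)")
    case False
    then show ?thesis by (cases j) (auto simp: coeff_nhermite)
  next
    case True
    then obtain m where m: "Suc (Suc n) = j + 2 * m"
      by (metis evenE le_add_diff_inverse)
    let ?c = "\<lambda>m. (-1) ^ m * 2 ^ j / (fact m * fact j) :: 'a"
    have lead: "of_nat j * ?c m = 2 * coeff (pCons 0 (nhermite (Suc n))) j"
    proof (cases j)
      case (Suc i)
      then have "Suc n = i + 2 * m" using m by simp
      then have "coeff (nhermite (Suc n)) i = ((-1) ^ m * 2 ^ i / (fact m * fact i) :: 'a)"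
        by (simp only: coeff_nhermite_add)
      then show ?thesis
        using Suc by (simp add: field_simps del: of_nat_Suc)
    qed simp
    have low: "of_nat m * ?c m = - coeff (nhermite n :: 'a poly) j"
    proof (cases m)
      case 0
      then show ?thesis using m by (simp add: coeff_nhermite)
    next
      case (Suc i)
      then have "n = j + 2 * i" using m by simp
      then have "coeff (nhermite n) j = ((-1) ^ i * 2 ^ j / (fact i * fact j) :: 'a)"
        by (simp only: coeff_nhermite_add)
      then show ?thesis
        using Suc by (simp add: field_simps del: of_nat_Suc)
    qed
    have "coeff (smult (of_nat (Suc (Suc n))) (nhermite (Suc (Suc n)))) j =
        of_nat j * ?c m + 2 * (of_nat m * ?c m)"
      unfolding m by (simp add: coeff_nhermite_add distrib_right add_divide_distrib mult.assoc)
    then show ?thesis unfolding lead low by (simp add: coeff_pCons split: nat.split)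
  qed
qed

section \<open>Generating functions\<close>

definition hermite_gf :: "'a::field_char_0 poly fps" where
  "hermite_gf = Abs_fps nhermite"

text \<open>The series \<open>F(x, t)\<close> with \<open>(x, t)\<close> replaced by \<open>(\<i> x, \<i> t)\<close>.\<close>

definition hermite_gf_inv :: "complex poly fps" where
  "hermite_gf_inv = Abs_fps (\<lambda>n. smult (\<i> ^ n) (pcompose (nhermite n) [:0, \<i>:]))"

text \<open>
  Coefficientwise this is the three-term recurrence; the coefficient of \<open>t\<^sup>0\<close>, where no lower term
  exists, is \<open>h\<^sub>1 = 2 x h\<^sub>0\<close>.
\<close>

lemma fps_deriv_hermite_gf:
  "fps_deriv hermite_gf = (fps_const [:0, 2:] - 2 * fps_X) * (hermite_gf :: 'a::field_char_0 poly fps)"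
proof (rule fps_ext)
  fix n
  show "fps_nth (fps_deriv hermite_gf) n =
    fps_nth ((fps_const [:0, 2:] - 2 * fps_X) * (hermite_gf :: 'a poly fps)) n"
  proof (cases n)
    case 0
    then show ?thesis
      by (simp add: hermite_gf_def nhermite_0 nhermite_1 left_diff_distrib mult.assoc)
  next
    case (Suc m)
    then show ?thesis
      using nhermite_recurrence[of m, where 'a = 'a]
      by (simp add: hermite_gf_def left_diff_distrib mult.assoc numeral_fps_const of_nat_poly
          numeral_poly del: of_nat_Suc)
  qed
qed

text \<open>
  The same recurrence at \<open>\<i> x\<close>, multiplied by \<open>\<i>\<^sup>n\<^sup>+\<^sup>2\<close>: both terms on the right change sign
  because \<open>\<i>\<^sup>2 = -1\<close>.
\<close>

lemma fps_deriv_hermite_gf_inv: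
  "fps_deriv hermite_gf_inv = (2 * fps_X - fps_const [:0, 2:]) * hermite_gf_inv"
proof (rule fps_ext)
  fix n
  show "fps_nth (fps_deriv hermite_gf_inv) n =
    fps_nth ((2 * fps_X - fps_const [:0, 2:]) * hermite_gf_inv) n"
  proof (cases n)
    case 0
    then show ?thesis
      by (simp add: hermite_gf_inv_def nhermite_0 nhermite_1 left_diff_distrib mult.assoc
          pcompose_pCons pcompose_1)
  next
    case (Suc m)
    let ?r = "\<lambda>n. pcompose (nhermite n) [:0, \<i>:]"
    have "smult (of_nat (Suc (Suc m))) (?r (Suc (Suc m))) =
        smult (2 * \<i>) (pCons 0 (?r (Suc m))) - smult 2 (?r m)"
      using arg_cong[OF nhermite_recurrence[of m], of "\<lambda>p. pcompose p [:0, \<i>:]"]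
      by (simp add: pcompose_smult pcompose_diff pcompose_pCons del: of_nat_Suc)
    from arg_cong[OF this, of "smult (\<i> ^ Suc (Suc m))"]
    have "smult (of_nat (Suc (Suc m))) (smult (\<i> ^ Suc (Suc m)) (?r (Suc (Suc m)))) =
        smult 2 (smult (\<i> ^ m) (?r m)) - smult 2 (pCons 0 (smult (\<i> ^ Suc m) (?r (Suc m))))"
      by (simp add: smult_diff_right mult_ac del: of_nat_Suc)
    with Suc show ?thesis
      by (simp add: hermite_gf_inv_def left_diff_distrib mult.assoc numeral_fps_const of_nat_poly
          numeral_poly del: of_nat_Suc)
        (simp add: mult_ac del: of_nat_Suc)
  qed
qed

text \<open>The two logarithmic derivatives cancel, so the product is constant in \<open>t\<close>.\<close>

lemma hermite_gf_mult_inv: "hermite_gf * hermite_gf_inv = 1"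
proof -
  have "fps_deriv (hermite_gf * hermite_gf_inv) = 0"
    by (simp add: fps_deriv_hermite_gf fps_deriv_hermite_gf_inv algebra_simps)
  then have "hermite_gf * hermite_gf_inv = fps_const (fps_nth (hermite_gf * hermite_gf_inv) 0)"
    by (rule fps_deriv_eq_0_iff[THEN iffD1])
  also have "\<dots> = 1"
    by (simp add: hermite_gf_def hermite_gf_inv_def nhermite_0 pcompose_1)
  finally show ?thesis .
qed

section \<open>Operators that are diagonal in the Hermite basis\<close>

lemma map_poly_of_real_nhermite: "map_poly complex_of_real (nhermite n) = nhermite n"
  by (rule poly_eqI) (auto simp: coeff_map_poly coeff_nhermite)

lemma smult_sum_distrib: "smult c (\<Sum>k\<in>A. p k) = (\<Sum>k\<in>A. smult c (p k))"
  by (induction A rule: infinite_finite_induct) (simp_all add: smult_add_right)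

lemma map_poly_of_real_sum_mult:
  "map_poly of_real (\<Sum>k\<in>A. p k * q k) = (\<Sum>k\<in>A. map_poly of_real (p k) * map_poly of_real (q k))"
  by (rule poly_eqI) (simp add: coeff_map_poly coeff_sum coeff_mult)

text \<open>
  Derivatives of order beyond the degree vanish, so the sum over all \<open>k\<close> becomes a Cauchy product.
\<close>

lemma diff_op_nhermite:
  "diff_op Q (nhermite n) = (\<Sum>k = 0..n. smult (2 ^ k) (Q k) * nhermite (n - k))"
proof -
  have "diff_op Q (nhermite n) = (\<Sum>k = 0..n. Q k * (pderiv ^^ k) (nhermite n))"
    unfolding diff_op_eq_sum
    by (rule sum.mono_neutral_left) (use degree_nhermite_le[of n] in \<open>auto intro: le_trans simp: higher_pderiv_eq_0\<close>)
  then show ?thesis by (simp add: higher_pderiv_nhermite)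
qed

lemma diff_op_smult: "diff_op Q (smult c p) = smult c (diff_op Q p)"
proof -
  have "(pderiv ^^ k) (smult c p) = smult c ((pderiv ^^ k) p)" for k
    by (induction k) (simp_all add: pderiv_smult)
  then show ?thesis
    by (cases "c = 0") (simp_all add: diff_op_eq_sum smult_sum_distrib)
qed

theorem theorem38:
  fixes \<gamma> :: "nat \<Rightarrow> real" and Q :: "nat \<Rightarrow> real poly"
  assumes "\<And>n. diff_op Q (hermite n) = smult (\<gamma> n) (hermite n)"
  shows "\<And>n. map_poly complex_of_real (Q n) =
    smult (1 / (fact n * 2 ^ n))
      (\<Sum>k = 0..n. smult (of_nat (n choose k) * complex_of_real (\<gamma> k) * \<i> ^ (n - k))
         (pcompose (hermite (n - k)) [:0, \<i>:] * hermite k))"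
proof -
  fix n
  define S :: "complex poly fps"
    where "S = Abs_fps (\<lambda>k. smult (2 ^ k) (map_poly of_real (Q k)))"
  define E :: "complex poly fps"
    where "E = Abs_fps (\<lambda>k. smult (of_real (\<gamma> k)) (nhermite k))"
  \<comment> \<open>The \<open>m\<close>-th coefficient is the eigenvalue equation for \<open>H\<^sub>m\<close>, divided by \<open>m!\<close>.\<close>
  have "S * hermite_gf = E"
  proof (rule fps_ext)
    fix m
    have "diff_op Q (nhermite m) = smult (\<gamma> m) (nhermite m)"
      using assms[of m] by (simp add: nhermite_def diff_op_smult mult.commute)
    then have "map_poly complex_of_real (\<Sum>k = 0..m. smult (2 ^ k) (Q k) * nhermite (m - k)) =
        map_poly of_real (smult (\<gamma> m) (nhermite m))"
      by (simp only: diff_op_nhermite)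
    then show "fps_nth (S * hermite_gf) m = fps_nth E m"
      by (simp add: S_def E_def hermite_gf_def fps_mult_nth map_poly_of_real_sum_mult
          map_poly_smult map_poly_of_real_nhermite del: mult_smult_left)
  qed
  then have "E * hermite_gf_inv = S * (hermite_gf * hermite_gf_inv)"
    by (simp add: mult.assoc)
  then have "S = E * hermite_gf_inv"
    by (simp add: hermite_gf_mult_inv)
  then have "smult (2 ^ n) (map_poly of_real (Q n)) = fps_nth (E * hermite_gf_inv) n"
    by (metis S_def fps_nth_Abs_fps)
  also have "\<dots> = (\<Sum>k = 0..n. smult (of_real (\<gamma> k) * \<i> ^ (n - k))
      (pcompose (nhermite (n - k)) [:0, \<i>:] * nhermite k))"
    by (simp add: E_def hermite_gf_inv_def fps_mult_nth mult_ac)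
  also have "\<dots> = smult (1 / fact n) (\<Sum>k = 0..n.
      smult (of_nat (n choose k) * complex_of_real (\<gamma> k) * \<i> ^ (n - k))
         (pcompose (hermite (n - k)) [:0, \<i>:] * hermite k))"
    unfolding smult_sum_distrib
    by (intro sum.cong refl) (simp add: hermite_eq_nhermite pcompose_smult binomial_fact mult_ac)
  finally have "smult (1 / 2 ^ n) (smult (2 ^ n) (map_poly of_real (Q n))) = smult (1 / 2 ^ n) \<dots>"
    by simp
  then show "map_poly complex_of_real (Q n) =
    smult (1 / (fact n * 2 ^ n))
      (\<Sum>k = 0..n. smult (of_nat (n choose k) * complex_of_real (\<gamma> k) * \<i> ^ (n - k))
         (pcompose (hermite (n - k)) [:0, \<i>:] * hermite k))"
    by (simp add: mult.commute)
qed

end
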